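(* Let $s,v,m$ be positive integers and $\epsilon\in\{1,-1\}$ (excluding $\epsilon=-1$, $vm^2\le4$) such that $d=svm/2$ and $k=s^2v(vm^2+4\epsilon)/4$ are integers, and let $f(x)=\dfrac{dx+k}{x+d}$. Let $a_0=0$, $a_1=1$, $a_{n+1}=v_nma_n+\epsilon a_{n-1}$, where $v_n=v$ for even $n$ and $v_n=1$ for odd $n$. Then for $n\ge1$, the iterate $f^n(\infty)$ is Pellian (i.e. equals $p/q$ with $p,q$ positive integers satisfying $p^2-kq^2=\pm1$) if and only if both of the following hold: (i) $n$ is even or $v=1$; (ii) $s$ divides $a_n$.
   Context: $f$ acts on $\mathbb{R}\cup\{\infty\}$ with $f(\infty)=d$; $f^n$ is its $n$-fold composite. *)

theory Defs
  imports Complex_Main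
begin

(* The map x |-> (d x + k) / (x + d) on the reals with one point at infinity,
   encoded as "real option" with None for infinity. *)
definition moebius :: "int \<Rightarrow> int \<Rightarrow> real option \<Rightarrow> real option" where
  "moebius d k x =
     (case x of
        None \<Rightarrow> Some (of_int d)
      | Some t \<Rightarrow>
          (if t + of_int d = 0 then None
           else Some ((of_int d * t + of_int k) / (t + of_int d))))"

definition pellian :: "int \<Rightarrow> real option \<Rightarrow> bool" where
  "pellian k x \<longleftrightarrow>
     (\<exists>p q :: int. p > 0 \<and> q > 0 \<and> x = Some (of_int p / of_int q) \<and>
        (p\<^sup>2 - k * q\<^sup>2 = 1 \<or> p\<^sup>2 - k * q\<^sup>2 = -1))"

definition vcoeff :: "int \<Rightarrow> nat \<Rightarrow> int" where
  "vcoeff v n = (if even n then v else 1)"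

fun aseq :: "int \<Rightarrow> int \<Rightarrow> int \<Rightarrow> nat \<Rightarrow> int" where
  "aseq v m \<epsilon> 0 = 0"
| "aseq v m \<epsilon> (Suc 0) = 1"
| "aseq v m \<epsilon> (Suc (Suc n)) =
     vcoeff v (Suc n) * m * aseq v m \<epsilon> (Suc n) + \<epsilon> * aseq v m \<epsilon> n"

end

theory Submission
  imports Defs
begin

text \<open>
  The iterates have the closed form
  \<open>f\<^sup>n\<^sup>+\<^sup>1(\<infinity>) = X / a\<^sub>n\<^sub>+\<^sub>1\<close> with \<open>X = d a\<^sub>n\<^sub>+\<^sub>1 + \<epsilon> s v\<^sub>n a\<^sub>n\<close>, and a Cassini-type identity
  for the sequence gives \<open>X\<^sup>2 - k a\<^sub>n\<^sub>+\<^sub>1\<^sup>2 = \<plusminus> s\<^sup>2 v\<^sub>n\<close>. If \<open>X / a\<^sub>n\<^sub>+\<^sub>1 = p / q\<close> with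
  \<open>p\<^sup>2 - k q\<^sup>2 = \<plusminus>1\<close>, comparing the two norms yields \<open>a\<^sub>n\<^sub>+\<^sub>1\<^sup>2 = q\<^sup>2 s\<^sup>2 v\<^sub>n\<close>. Since the terms of odd
  index are prime to \<open>v\<close>, this forces \<open>v\<^sub>n = 1\<close> and then \<open>a\<^sub>n\<^sub>+\<^sub>1 = q s\<close>. Conversely, if \<open>v\<^sub>n = 1\<close> and
  \<open>s\<close> divides \<open>a\<^sub>n\<^sub>+\<^sub>1\<close>, then \<open>s\<close> cancels from the fraction and leaves a representation of norm \<open>\<plusminus>1\<close>.
\<close>

lemma vcoeff_Suc_mult: "vcoeff v (Suc n) * vcoeff v n = v"
  by (simp add: vcoeff_def)

lemma vcoeff_pos: "v > 0 \<Longrightarrow> vcoeff v n > 0"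
  by (simp add: vcoeff_def)

lemma vcoeff_eq_1_iff: "vcoeff v n = 1 \<longleftrightarrow> odd n \<or> v = 1"
  by (simp add: vcoeff_def)

text \<open>For \<open>\<epsilon> = -1\<close> positivity alone does not survive the induction. The
  third conjunct puts the next term above half of its leading summand, and it also makes the
  numerators of the iterates positive.\<close>

lemma aseq_Suc_pos_and_dominates:
  fixes v m \<epsilon> :: int
  assumes "v > 0" "m > 0" "\<epsilon> \<in> {1, -1}" "\<not> (\<epsilon> = -1 \<and> v * m\<^sup>2 \<le> 4)"
  shows "aseq v m \<epsilon> n \<ge> 0 \<and> aseq v m \<epsilon> (Suc n) > 0 \<and>
         vcoeff v (Suc n) * m * aseq v m \<epsilon> (Suc n) + 2 * \<epsilon> * aseq v m \<epsilon> n > 0"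
proof (induction n)
  case 0
  show ?case using assms vcoeff_pos[of v "Suc 0"] by simp
next
  case (Suc n)
  define a b c where "a = aseq v m \<epsilon> n" and "b = aseq v m \<epsilon> (Suc n)"
    and "c = aseq v m \<epsilon> (Suc (Suc n))"
  define w w' where "w = vcoeff v n" and "w' = vcoeff v (Suc n)"
  have c: "c = w' * m * b + \<epsilon> * a" by (simp add: a_def b_def c_def w'_def)
  have w'': "vcoeff v (Suc (Suc n)) = w" by (simp add: w_def vcoeff_def)
  have ww: "w' * w = v" using vcoeff_Suc_mult by (simp add: w_def w'_def)
  have w: "w > 0" "w' > 0" using vcoeff_pos assms(1) by (auto simp: w_def w'_def)
  have IH: "a \<ge> 0" "b > 0" "w' * m * b + 2 * \<epsilon> * a > 0"
    using Suc.IH by (auto simp: a_def b_def w'_def)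
  have wb: "w' * m * b > 0" using w IH assms(2) by simp
  have c2: "2 * c > w' * m * b"
    using IH(3) unfolding c by (simp add: algebra_simps)
  have cpos: "c > 0" using c2 wb by linarith
  have "w * m * c + 2 * \<epsilon> * b > 0"
  proof (cases "\<epsilon> = 1")
    case True
    then show ?thesis using w assms(2) cpos IH by (simp add: add_pos_pos)
  next
    case False
    then have e: "\<epsilon> = -1" using assms(3) by simp
    have "w * m * (2 * c) > w * m * (w' * m * b)"
      using c2 w assms(2) by (intro mult_strict_left_mono) auto
    also have "w * m * (w' * m * b) = v * m\<^sup>2 * b"
      by (simp add: ww[symmetric] power2_eq_square)
    finally have 1: "w * m * (2 * c) > v * m\<^sup>2 * b" .
    \<comment> \<open>The excluded case enters here: with \<open>v * m\<^sup>2 > 4\<close>, the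
      bound on \<open>2 * c\<close> gives \<open>w * m * c > 2 * b\<close>.\<close>
    have "v * m\<^sup>2 * b \<ge> 4 * b" using assms(4) e IH by (intro mult_right_mono) auto
    then show ?thesis using 1 e by simp
  qed
  then show ?case using cpos IH unfolding w'' by (simp add: b_def c_def w_def)
qed

text \<open>One step of the recurrence multiplies this quadratic form by
  \<open>- \<epsilon>\<close>, while the two alternating coefficients trade places.\<close>

lemma aseq_cassini:
  fixes v m \<epsilon> :: int
  assumes "\<epsilon> \<in> {1, -1}"
  shows "- \<epsilon> * vcoeff v (Suc n) * (aseq v m \<epsilon> (Suc n))\<^sup>2
         + \<epsilon> * v * m * aseq v m \<epsilon> (Suc n) * aseq v m \<epsilon> n
         + vcoeff v n * (aseq v m \<epsilon> n)\<^sup>2 = (- \<epsilon>) ^ Suc n"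
proof (induction n)
  case 0
  show ?case by (simp add: vcoeff_def)
next
  case (Suc n)
  define a b where "a = aseq v m \<epsilon> n" and "b = aseq v m \<epsilon> (Suc n)"
  define w w' where "w = vcoeff v n" and "w' = vcoeff v (Suc n)"
  have w'': "vcoeff v (Suc (Suc n)) = w" by (simp add: w_def vcoeff_def)
  have ww: "v = w' * w" using vcoeff_Suc_mult by (simp add: w_def w'_def)
  have e: "\<epsilon> * \<epsilon> = 1" using assms by auto
  have c: "aseq v m \<epsilon> (Suc (Suc n)) = w' * m * b + \<epsilon> * a"
    by (simp add: a_def b_def w'_def)
  have IH: "- \<epsilon> * w' * b\<^sup>2 + \<epsilon> * v * m * b * a + w * a\<^sup>2 = (- \<epsilon>) ^ Suc n"
    using Suc.IH by (simp add: a_def b_def w_def w'_def)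
  have "- \<epsilon> * w * (w' * m * b + \<epsilon> * a)\<^sup>2 + \<epsilon> * v * m * (w' * m * b + \<epsilon> * a) * b + w' * b\<^sup>2
      = - \<epsilon> * (- \<epsilon> * w' * b\<^sup>2 + \<epsilon> * v * m * b * a + w * a\<^sup>2)"
    using e unfolding ww by algebra
  also have "\<dots> = (- \<epsilon>) ^ Suc (Suc n)" unfolding IH by simp
  finally show ?case unfolding w'' c by (simp add: b_def w'_def)
qed

text \<open>Two steps from an odd index to the next pass through the coefficient \<open>v\<close>,
  so modulo \<open>v\<close> they only multiply the term by \<open>\<epsilon>\<close>, starting from
  1.\<close>

lemma coprime_aseq_odd:
  fixes v m \<epsilon> :: int
  assumes "\<epsilon> \<in> {1, -1}"
  shows "coprime v (aseq v m \<epsilon> (Suc (2 * n)))"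
proof (induction n)
  case 0
  show ?case by simp
next
  case (Suc n)
  have "aseq v m \<epsilon> (Suc (2 * Suc n))
      = v * (m * aseq v m \<epsilon> (Suc (Suc (2 * n)))) + \<epsilon> * aseq v m \<epsilon> (Suc (2 * n))"
    by (simp add: vcoeff_def)
  moreover have "coprime v (\<epsilon> * aseq v m \<epsilon> (Suc (2 * n)))"
    using Suc assms by auto
  ultimately show ?case
    using gcd_add_mult[of v "m * aseq v m \<epsilon> (Suc (Suc (2 * n)))"]
    by (simp only: coprime_iff_gcd_eq_1 mult.commute[of v])
qed

text \<open>Applying the map to \<open>X / b\<close> produces a common factor \<open>s * w\<close>
  in numerator and denominator. Cancelling it leaves the next term as denominator; this is positive,
  so the orbit never returns to infinity.\<close>

lemma moebius_funpow_None:
  fixes s v m \<epsilon> d k :: int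
  assumes "s > 0" "v > 0" "m > 0" "\<epsilon> \<in> {1, -1}" "\<not> (\<epsilon> = -1 \<and> v * m\<^sup>2 \<le> 4)"
    and d: "2 * d = s * v * m" and k: "k = d\<^sup>2 + \<epsilon> * s\<^sup>2 * v"
  shows "(moebius d k ^^ Suc n) None =
    Some (of_int (d * aseq v m \<epsilon> (Suc n) + \<epsilon> * s * vcoeff v n * aseq v m \<epsilon> n)
          / of_int (aseq v m \<epsilon> (Suc n)))"
proof (induction n)
  case 0
  show ?case by (simp add: moebius_def)
next
  case (Suc n)
  define a b c where "a = aseq v m \<epsilon> n" and "b = aseq v m \<epsilon> (Suc n)"
    and "c = aseq v m \<epsilon> (Suc (Suc n))"
  define w w' where "w = vcoeff v n" and "w' = vcoeff v (Suc n)"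
  define X where "X = d * b + \<epsilon> * s * w * a"
  have c: "c = w' * m * b + \<epsilon> * a" by (simp add: a_def b_def c_def w'_def)
  have ww: "v = w' * w" using vcoeff_Suc_mult by (simp add: w_def w'_def)
  have w: "w > 0" using vcoeff_pos assms(2) by (auto simp: w_def)
  have pos: "b > 0" "c > 0"
    using aseq_Suc_pos_and_dominates[of v m \<epsilon>] assms unfolding b_def c_def by blast+
  have den: "X + d * b = s * w * c"
  proof -
    have "X + d * b = (2 * d) * b + \<epsilon> * s * w * a" by (simp add: X_def)
    also have "\<dots> = s * w * c" unfolding d ww c by (simp add: algebra_simps)
    finally show ?thesis .
  qed
  have num: "d * X + k * b = s * w * (d * c + \<epsilon> * s * w' * b)"
  proof -
    have "d * X + k * b = d * (X + d * b) + \<epsilon> * s\<^sup>2 * v * b"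
      unfolding k by (simp add: algebra_simps power2_eq_square)
    also have "\<dots> = s * w * (d * c + \<epsilon> * s * w' * b)"
      unfolding den ww by (simp add: algebra_simps power2_eq_square)
    finally show ?thesis .
  qed
  have swc: "s * w * c \<noteq> 0" using assms(1) w pos by simp
  have t: "real_of_int X / of_int b + of_int d = of_int (X + d * b) / of_int b"
    using pos by (simp add: field_simps)
  have t': "of_int d * (real_of_int X / of_int b) + of_int k = of_int (d * X + k * b) / of_int b"
    using pos by (simp add: field_simps)
  have "moebius d k (Some (of_int X / of_int b))
      = Some (of_int (d * X + k * b) / of_int (X + d * b))"
    unfolding moebius_def option.case t t' using pos swc den
    by (simp del: of_int_mult of_int_add)
  also have "\<dots> = Some (of_int (d * c + \<epsilon> * s * w' * b) / of_int c)"
    unfolding num den using swc assms(1) w by (simp add: of_int_mult[of "s * w"] del: of_int_add)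
  finally show ?case
    using Suc.IH by (simp add: a_def b_def c_def w_def w'_def X_def)
qed

lemma norm_cross_mult:
  fixes p q X Y k :: int
  assumes "p * Y = X * q"
  shows "(p\<^sup>2 - k * q\<^sup>2) * Y\<^sup>2 = q\<^sup>2 * (X\<^sup>2 - k * Y\<^sup>2)"
  using assms by algebra

theorem theorem6p1:
  fixes s v m \<epsilon> d k :: int and n :: nat
  assumes "s > 0" and "v > 0" and "m > 0"
    and "\<epsilon> \<in> {1, -1}"
    and "\<not> (\<epsilon> = -1 \<and> v * m\<^sup>2 \<le> 4)"
    and "real_of_int d = real_of_int (s * v * m) / 2"
    and "real_of_int k = real_of_int (s\<^sup>2 * v * (v * m\<^sup>2 + 4 * \<epsilon>)) / 4"
    and "n \<ge> 1"
  shows "pellian k ((moebius d k ^^ n) None) \<longleftrightarrow>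
           (even n \<or> v = 1) \<and> s dvd aseq v m \<epsilon> n"
proof -
  obtain l where n: "n = Suc l" using \<open>n \<ge> 1\<close> by (cases n) auto
  have "real_of_int (2 * d) = real_of_int (s * v * m)" using assms(6) by simp
  then have d: "2 * d = s * v * m" by (simp only: of_int_eq_iff)
  have "real_of_int (4 * k) = real_of_int (s\<^sup>2 * v * (v * m\<^sup>2 + 4 * \<epsilon>))" using assms(7) by simp
  then have "4 * k = s\<^sup>2 * v * (v * m\<^sup>2 + 4 * \<epsilon>)" by (simp only: of_int_eq_iff)
  also have "\<dots> = (s * v * m)\<^sup>2 + 4 * (\<epsilon> * s\<^sup>2 * v)"
    by (simp add: algebra_simps power2_eq_square)
  also have "\<dots> = 4 * (d\<^sup>2 + \<epsilon> * s\<^sup>2 * v)"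
    unfolding d[symmetric] by (simp add: power2_eq_square)
  finally have k: "k = d\<^sup>2 + \<epsilon> * s\<^sup>2 * v" by simp
  define a b where "a = aseq v m \<epsilon> l" and "b = aseq v m \<epsilon> (Suc l)"
  define w w' where "w = vcoeff v l" and "w' = vcoeff v (Suc l)"
  define X where "X = d * b + \<epsilon> * s * w * a"
  have ww: "v = w' * w" using vcoeff_Suc_mult by (simp add: w_def w'_def)
  have w: "w > 0" using vcoeff_pos assms(2) by (auto simp: w_def)
  have iter: "(moebius d k ^^ n) None = Some (of_int X / of_int b)"
    using moebius_funpow_None[of s v m \<epsilon> d k l] assms d k by (simp add: n a_def b_def X_def w_def)
  have bpos: "b > 0" and dom: "w' * m * b + 2 * \<epsilon> * a > 0"
    using aseq_Suc_pos_and_dominates[of v m \<epsilon> l] assms by (auto simp: a_def b_def w'_def)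
  \<comment> \<open>Doubling lets \<open>2 * d = s * v * m\<close> replace \<open>d\<close>, which
    exposes the dominance bound.\<close>
  have "2 * X = (2 * d) * b + 2 * (\<epsilon> * s * w * a)" by (simp add: X_def)
  also have "\<dots> = s * w * (w' * m * b + 2 * \<epsilon> * a)" unfolding d ww by (simp add: algebra_simps)
  also have "\<dots> > 0" using dom w assms(1) by simp
  finally have Xpos: "X > 0" by simp
  have e: "\<epsilon> * \<epsilon> = 1" using assms(4) by auto
  \<comment> \<open>The squares of \<open>d\<close> cancel. Replacing \<open>2 * d\<close> in the
    cross term then leaves \<open>s\<^sup>2 * w\<close> times the Cassini form.\<close>
  have "X\<^sup>2 - k * b\<^sup>2 = - \<epsilon> * s\<^sup>2 * v * b\<^sup>2 + (2 * d) * (\<epsilon> * s * w * a * b) + s\<^sup>2 * w\<^sup>2 * a\<^sup>2"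
    unfolding X_def k using e by algebra
  also have "\<dots> = s\<^sup>2 * w * (- \<epsilon> * w' * b\<^sup>2 + \<epsilon> * v * m * b * a + w * a\<^sup>2)"
    unfolding d ww by (simp add: algebra_simps power2_eq_square)
  also have "\<dots> = s\<^sup>2 * w * (- \<epsilon>) ^ n"
    using aseq_cassini[of \<epsilon> v l m] assms(4) by (simp add: a_def b_def w_def w'_def n)
  finally have norm: "X\<^sup>2 - k * b\<^sup>2 = s\<^sup>2 * w * (- \<epsilon>) ^ n" .
  have sign: "(- \<epsilon>) ^ n = 1 \<or> (- \<epsilon>) ^ n = -1"
    using assms(4) by (cases "even n") auto
  \<comment> \<open>Condition (i) is \<open>w = 1\<close>: since \<open>w\<close> is the coefficient
    at \<open>l\<close>, one below \<open>n\<close>, the parity flips.\<close>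
  have "pellian k (Some (of_int X / of_int b)) \<longleftrightarrow> w = 1 \<and> s dvd b"
  proof
    assume "pellian k (Some (of_int X / of_int b))"
    then obtain p q :: int where pq: "p > 0" "q > 0"
      "real_of_int X / of_int b = of_int p / of_int q"
      and pell: "p\<^sup>2 - k * q\<^sup>2 = 1 \<or> p\<^sup>2 - k * q\<^sup>2 = -1"
      unfolding pellian_def by auto
    have "real_of_int (p * b) = real_of_int (X * q)"
      using pq bpos by (simp add: field_simps)
    then have "p * b = X * q" by (simp only: of_int_eq_iff)
    from norm_cross_mult[OF this, of k]
    have "(p\<^sup>2 - k * q\<^sup>2) * b\<^sup>2 = q\<^sup>2 * s\<^sup>2 * w * (- \<epsilon>) ^ n" unfolding norm by simp
    \<comment> \<open>Absolute values remove both undetermined signs.\<close>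
    then have "\<bar>(p\<^sup>2 - k * q\<^sup>2) * b\<^sup>2\<bar> = \<bar>q\<^sup>2 * s\<^sup>2 * w * (- \<epsilon>) ^ n\<bar>" by simp
    moreover have "\<bar>p\<^sup>2 - k * q\<^sup>2\<bar> = 1" "\<bar>(- \<epsilon>) ^ n\<bar> = 1" using pell sign by linarith+
    ultimately have sq: "b\<^sup>2 = q\<^sup>2 * s\<^sup>2 * w" using w by (simp only: abs_mult) simp
    have w1: "w = 1"
    proof (cases "odd l")
      case True
      then show ?thesis by (simp add: w_def vcoeff_eq_1_iff)
    next
      case False
      then obtain j where "l = 2 * j" by (auto elim: evenE)
      \<comment> \<open>Here \<open>w = v\<close>, so \<open>v\<close> divides
        \<open>b\<^sup>2\<close> although \<open>b\<close> has odd index and is prime to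
        \<open>v\<close>; hence \<open>v\<close> is a unit.\<close>
      then have "coprime v (b\<^sup>2)" using coprime_aseq_odd[of \<epsilon> v m j] assms(4) by (simp add: b_def)
      moreover have "v dvd b\<^sup>2" using sq False by (simp add: w_def vcoeff_def)
      ultimately have "is_unit v" using coprime_common_divisor[of v "b\<^sup>2" v] by simp
      then have "v = 1" using assms(2) by simp
      then show ?thesis by (simp add: w_def vcoeff_eq_1_iff)
    qed
    then have "b\<^sup>2 = (q * s)\<^sup>2" using sq by (simp add: power_mult_distrib)
    then have "b = q * s" using bpos pq assms(1) by (simp add: power2_eq_iff_nonneg)
    then show "w = 1 \<and> s dvd b" using w1 by simp
  next
    assume A: "w = 1 \<and> s dvd b"
    then obtain q where q: "b = s * q" by blast
    \<comment> \<open>This is \<open>X / s\<close> when \<open>w = 1\<close>; dividing the pair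
      \<open>X\<close>, \<open>b\<close> by \<open>s\<close> divides its norm by
      \<open>s\<^sup>2\<close>.\<close>
    define p where "p = d * q + \<epsilon> * a"
    have X: "X = s * p" using A q by (simp add: X_def p_def algebra_simps)
    have pos: "p > 0" "q > 0" using Xpos bpos X q assms(1) by (auto simp: zero_less_mult_iff)
    have "s\<^sup>2 * (p\<^sup>2 - k * q\<^sup>2) = s\<^sup>2 * (- \<epsilon>) ^ n"
      using norm A unfolding X q by (simp add: algebra_simps power_mult_distrib)
    then have "p\<^sup>2 - k * q\<^sup>2 = (- \<epsilon>) ^ n" using assms(1) by simp
    moreover have "real_of_int X / of_int b = of_int p / of_int q"
      using assms(1) X q by simp
    ultimately show "pellian k (Some (of_int X / of_int b))"
      unfolding pellian_def using pos sign by (intro exI[of _ p] exI[of _ q]) simp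
  qed
  then show ?thesis unfolding iter by (simp add: w_def vcoeff_eq_1_iff b_def n)
qed

end
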